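(* For every positive integer $n$ the Hankel determinant $H_n(F_3(x))$ satisfies $$\frac{H_n(F_3(x))}{2^{n-1}}\equiv\begin{cases}1\pmod 6 & \text{if } n\equiv 0,1\pmod 4,\\ 5\pmod 6 & \text{if } n\equiv 2,3\pmod 4.\end{cases}$$
   Context: $F_3(x)=\prod_{k=0}^\infty\left(1-x^{3^k}-x^{2\cdot 3^k}\right)$, a formal power series all of whose coefficients are $\pm1$. For a power series $\tilde{\bf c}(x)=\sum_{k\ge0}c_kx^k$, the Hankel determinant of order $n\ge1$ is $H_n(\tilde{\bf c}(x))=\det(c_{i+j})_{0\le i,j\le n-1}$. (The quotient $H_n(F_3(x))/2^{n-1}$ is an integer.) *)

theory Defs
  imports
    "HOL-Analysis.Infinite_Products"
    "HOL-Computational_Algebra.Formal_Power_Series"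
    "HOL-Number_Theory.Cong"
    "Jordan_Normal_Form.Determinant"
begin

(* The infinite product is the limit of partial products for the library metric on
   formal power series, i.e. coefficientwise stabilisation. *)
definition F3 :: "int fps" where
  "F3 = (\<Prod>k. 1 - fps_X ^ (3 ^ k) - fps_X ^ (2 * 3 ^ k))"

definition hankel_det :: "nat \<Rightarrow> 'a::comm_ring_1 fps \<Rightarrow> 'a" where
  "hankel_det n c = Determinant.det (mat n n (\<lambda>(i, j). fps_nth c (i + j)))"

(* prodinf is a definite description; convergence makes it meaningful here. *)
lemma F3_has_prod: "(\<lambda>k. 1 - fps_X ^ (3 ^ k) - fps_X ^ (2 * 3 ^ k)) has_prod F3"
proof -
  define f :: "nat \<Rightarrow> int fps" where "f = (\<lambda>k. 1 - fps_X ^ (3 ^ k) - fps_X ^ (2 * 3 ^ k))"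
  define P where "P = (\<lambda>n. \<Prod>k\<le>n. f k)"
  have lt: "n < 3 ^ Suc n" for n :: nat
    by (induction n) auto
  have P_Suc: "fps_nth (P (Suc n)) j = fps_nth (P n) j" if "j \<le> n" for n j
  proof -
    define m :: nat where "m = 3 ^ Suc n"
    have j: "j < m" "j < 2 * m"
      using lt[of n] that unfolding m_def by linarith+
    have "P (Suc n) = P n * f (Suc n)"
      unfolding P_def by (rule prod.atMost_Suc)
    also have "f (Suc n) = 1 - fps_X ^ m - fps_X ^ (2 * m)"
      unfolding f_def m_def ..
    also have "P n * \<dots> = P n - fps_X ^ m * P n - fps_X ^ (2 * m) * P n"
      by (simp only: right_diff_distrib mult_1_left mult_1_right mult.commute)
    finally have "P (Suc n) = P n - fps_X ^ m * P n - fps_X ^ (2 * m) * P n" .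
    with j show ?thesis by (simp only: fps_sub_nth fps_X_power_mult_nth if_True diff_zero)
  qed
  have stable: "fps_nth (P n) j = fps_nth (P j) j" if "j \<le> n" for n j
    using that
  proof (induction n rule: dec_induct)
    case base
    show ?case ..
  next
    case (step n)
    from P_Suc[OF step.hyps(1)] step.IH show ?case by (rule trans)
  qed
  define L where "L = Abs_fps (\<lambda>j. fps_nth (P j) j)"
  have "P \<longlonglongrightarrow> L"
  proof (rule tendsto_fpsI)
    fix j
    show "eventually (\<lambda>n. fps_nth (P n) j = fps_nth L j) sequentially"
      using eventually_ge_at_top[of j]
    proof eventually_elim
      case (elim n)
      from stable[OF elim] show ?case by (simp add: L_def)
    qed
  qed
  moreover have "fps_nth L 0 = 1"
    by (simp add: L_def P_def f_def)
  then have "L \<noteq> 0" by auto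
  ultimately have "f has_prod L"
    unfolding has_prod_def raw_has_prod_def P_def by simp
  moreover from this have "L = prodinf f"
    by (rule has_prod_unique)
  ultimately show ?thesis
    unfolding F3_def f_def by simp
qed

end

theory Submission
  imports Defs
    "HOL-Computational_Algebra.Formal_Laurent_Series"
    "HOL-Library.Numeral_Type"
begin

text \<open>
The proof strips one level off a continued fraction: if \<open>G = 1 / (1 + a X + b X^2 K)\<close>, then the
Hankel determinants of \<open>G\<close> and \<open>K\<close> satisfy \<open>H (n + 1) G = (- b) ^ n * H n K\<close>
(\<open>hankel_det_Suc_J_fraction\<close>).

All coefficients of \<open>F3\<close> are odd, so \<open>1 / F3\<close> is congruent to \<open>1 - X\<close> modulo 2 and starts with \<open>1 + X\<close>; therefore
\<open>F3 = 1 / (1 + X + 2 X^2 K)\<close> with \<open>K\<close> an integer series (\<open>F3_J_fraction\<close>). One step gives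
\<open>H (m + 1) F3 = (- 2) ^ m * H m K\<close>, which explains the power of two. It remains to know the
Hankel determinants of \<open>K\<close> modulo 2 and modulo 3.

Modulo 3, cubing \<open>f = 1 - X - X^2\<close> amounts to substituting \<open>X^3\<close>, so the infinite product
telescopes to \<open>F3^2 f = 1\<close>. For \<open>K\<close> this means \<open>K (1 + X + X^2 K) = 1\<close>: its continued fraction
is periodic with period one, and repeated steps give \<open>H m K = (- 1) ^ (m choose 2)\<close>.

Modulo 2 the argument starts from the signs. Write the coefficients of \<open>F3\<close> as
\<open>(- 1) ^ d n\<close>, where \<open>d n\<close> counts the nonzero ternary digits of \<open>n\<close>. Then \<open>K\<close> has the coefficients
\<open>d n + d (n + 2)\<close> modulo 2. Comparing the ternary digits of \<open>n, n + 1\<close> with those of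
\<open>2 n + 1, 2 n + 2\<close> yields \<open>k n = k (2 n + 1) + k (2 n + 2)\<close> for these coefficients. As squaring
a series over the field with two elements substitutes \<open>X^2\<close>, the recurrence is the Riccati equation
\<open>K + (X + X^2) K' = 1 + X^2 K^2\<close>. A Riccati equation turns into a Riccati equation when one level
of a continued fraction is removed, and this one turns into itself. It also forces the constant
coefficient to be 1, so the steps can go on for ever with \<open>b = 1\<close>, and every Hankel determinant
of \<open>K\<close> is odd.
\<close>

section \<open>Hankel determinants and continued fractions\<close>

lemma hankel_det_0 [simp]: "hankel_det 0 G = 1"
  by (simp add: hankel_det_def)

lemma det_unit_lower_triangular:
  fixes A :: "'a::comm_ring_1 mat"
  assumes "A \<in> carrier_mat n n"
    and "\<And>i j. i < j \<Longrightarrow> j < n \<Longrightarrow> A $$ (i, j) = 0"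
    and "\<And>i. i < n \<Longrightarrow> A $$ (i, i) = 1"
  shows "det A = 1"
  using det_lower_triangular[OF assms(2,1)] assms by (simp add: prod_list_diag_prod)

lemma det_unit_upper_triangular:
  fixes A :: "'a::comm_ring_1 mat"
  assumes "A \<in> carrier_mat n n"
    and "\<And>i j. j < i \<Longrightarrow> i < n \<Longrightarrow> A $$ (i, j) = 0"
    and "\<And>i. i < n \<Longrightarrow> A $$ (i, i) = 1"
  shows "det A = 1"
  using det_upper_triangular[of A n] assms by (simp add: prod_list_diag_prod upper_triangular_def)

text \<open>
Let \<open>q = 1 / G\<close>. The unitriangular Toeplitz matrix \<open>T\<close> of \<open>q\<close> performs row operations that
compute convolutions of \<open>q\<close> with shifts of \<open>G\<close>. A full convolution vanishes in positive degree, so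
an entry of \<open>T\<close> times the Hankel matrix of \<open>G\<close> is minus the missing initial part of one. The first
column becomes a unit vector. In the remaining block the coefficients of \<open>q\<close> have index at least 2,
where they are those of \<open>b K\<close>, and the block is \<open>- b\<close> times the Hankel matrix of \<open>K\<close> times a
unitriangular Toeplitz matrix of \<open>G\<close>.
\<close>

theorem hankel_det_Suc_J_fraction:
  fixes G K :: "'a::comm_ring_1 fps" and a b :: 'a
  assumes GK: "G * (1 + fps_const a * fps_X + fps_const b * fps_X ^ 2 * K) = 1"
  shows "hankel_det (Suc n) G = (- b) ^ n * hankel_det n K"
proof -
  define q where "q = 1 + fps_const a * fps_X + fps_const b * fps_X ^ 2 * K"
  have q_0: "fps_nth q 0 = 1"
    by (simp add: q_def)
  have q_add_2: "fps_nth q (Suc (Suc i)) = b * fps_nth K i" for i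
    by (simp add: q_def mult.assoc fps_X_power_mult_nth)
  have G_0: "fps_nth G 0 = 1"
    using arg_cong[OF GK, of "\<lambda>f. fps_nth f 0"] by simp
  have conv: "(\<Sum>m\<le>d. fps_nth G m * fps_nth q (d - m)) = (if d = 0 then 1 else 0)" for d
    using arg_cong[OF GK[folded q_def], of "\<lambda>f. fps_nth f d"]
    by (simp add: fps_mult_nth atLeast0AtMost)
  define N where "N = Suc n"
  define T where "T = mat N N (\<lambda>(i, k). if k \<le> i then fps_nth q (i - k) else 0)"
  define H where "H = mat N N (\<lambda>(i, j). fps_nth G (i + j))"
  define U where "U = mat n n (\<lambda>(l, j). if l \<le> j then fps_nth G (j - l) else 0)"
  define HK where "HK = mat n n (\<lambda>(i, j). fps_nth K (i + j))"
  have carrier: "T \<in> carrier_mat N N" "H \<in> carrier_mat N N"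
    "U \<in> carrier_mat n n" "HK \<in> carrier_mat n n"
    by (simp_all add: T_def H_def U_def HK_def)
  have TH: "(T * H) $$ (i, j) =
      (if i + j = 0 then 1 else 0) - (\<Sum>m<j. fps_nth G m * fps_nth q (i + j - m))"
    if "i < N" "j < N" for i j
  proof -
    have "(T * H) $$ (i, j) = (\<Sum>k<N. T $$ (i, k) * H $$ (k, j))"
      using that by (simp add: T_def H_def scalar_prod_def atLeast0LessThan)
    also have "\<dots> = (\<Sum>k\<le>i. fps_nth q (i - k) * fps_nth G (k + j))"
      using that by (intro sum.mono_neutral_cong_right) (auto simp: T_def H_def)
    also have "\<dots> = (\<Sum>m\<in>{j..i + j}. fps_nth G m * fps_nth q (i + j - m))"
      by (rule sum.reindex_bij_witness[of _ "\<lambda>m. m - j" "\<lambda>k. k + j"]) (auto simp: mult.commute)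
    also have "\<dots> = (\<Sum>m\<le>i + j. fps_nth G m * fps_nth q (i + j - m))
        - (\<Sum>m<j. fps_nth G m * fps_nth q (i + j - m))"
    proof -
      have "{..i + j} = {..<j} \<union> {j..i + j}" by auto
      moreover have "{..<j} \<inter> {j..i + j} = {}" by auto
      ultimately show ?thesis by (simp add: sum.union_disjoint)
    qed
    finally show ?thesis by (simp only: conv)
  qed
  have minor: "mat_delete (T * H) 0 0 = (- b) \<cdot>\<^sub>m (HK * U)"
  proof (rule eq_matI)
    fix i j assume "i < dim_row ((- b) \<cdot>\<^sub>m (HK * U))" "j < dim_col ((- b) \<cdot>\<^sub>m (HK * U))"
    then have ij: "i < n" "j < n" by (simp_all add: HK_def U_def)
    have "mat_delete (T * H) 0 0 $$ (i, j) = (T * H) $$ (Suc i, Suc j)"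
      using ij by (simp add: mat_delete_def T_def H_def N_def)
    also have "\<dots> = - (\<Sum>m\<le>j. fps_nth G m * fps_nth q (Suc i + Suc j - m))"
      using ij by (simp add: TH N_def lessThan_Suc_atMost del: sum.lessThan_Suc sum.atMost_Suc)
    also have "(\<Sum>m\<le>j. fps_nth G m * fps_nth q (Suc i + Suc j - m)) =
        (\<Sum>m\<le>j. b * (fps_nth K (i + j - m) * fps_nth G m))"
      by (intro sum.cong) (simp_all add: Suc_diff_le q_add_2 mult_ac)
    also have "\<dots> = b * (\<Sum>m\<le>j. fps_nth K (i + j - m) * fps_nth G m)"
      by (simp add: sum_distrib_left)
    also have "(\<Sum>m\<le>j. fps_nth K (i + j - m) * fps_nth G m) =
        (\<Sum>l\<le>j. fps_nth K (i + l) * fps_nth G (j - l))"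
      by (rule sum.reindex_bij_witness[of _ "\<lambda>l. j - l" "\<lambda>m. j - m"]) auto
    also have "\<dots> = (\<Sum>l<n. HK $$ (i, l) * U $$ (l, j))"
      using ij by (intro sum.mono_neutral_cong_left) (auto simp: HK_def U_def)
    also have "\<dots> = (HK * U) $$ (i, j)"
      using ij by (simp add: HK_def U_def scalar_prod_def atLeast0LessThan)
    finally show "mat_delete (T * H) 0 0 $$ (i, j) = ((- b) \<cdot>\<^sub>m (HK * U)) $$ (i, j)"
      using ij by (simp add: HK_def U_def)
  qed (simp_all add: mat_delete_def T_def H_def HK_def U_def N_def)
  have "det T = 1"
    by (rule det_unit_lower_triangular[OF carrier(1)]) (auto simp: T_def q_0)
  then have "hankel_det (Suc n) G = det (T * H)"
    using det_mult[OF carrier(1,2)] by (simp add: hankel_det_def H_def N_def)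
  also have "\<dots> = (\<Sum>i<N. (T * H) $$ (i, 0) * cofactor (T * H) i 0)"
    using carrier by (intro laplace_expansion_column) (auto simp: N_def)
  also have "\<dots> = (\<Sum>i<N. if i = 0 then cofactor (T * H) 0 0 else 0)"
    by (intro sum.cong) (simp_all add: TH N_def)
  also have "\<dots> = det (mat_delete (T * H) 0 0)"
    by (simp add: N_def cofactor_def)
  also have "\<dots> = (- b) ^ n * (det HK * det U)"
    using carrier by (simp add: minor det_mult[of _ n])
  also have "det U = 1"
    by (rule det_unit_upper_triangular[OF carrier(3)]) (auto simp: U_def G_0)
  finally show ?thesis by (simp add: hankel_det_def HK_def)
qed

lemma fps_eq_const_linear_shift:
  fixes G :: "'a::comm_ring_1 fps"
  shows "G = fps_const (fps_nth G 0) + fps_const (fps_nth G 1) * fps_X + fps_X ^ 2 * fps_shift 2 G"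
proof (rule fps_ext)
  fix n show "fps_nth G n = fps_nth (fps_const (fps_nth G 0) + fps_const (fps_nth G 1) * fps_X +
      fps_X ^ 2 * fps_shift 2 G) n"
    by (cases n; cases "n - 1") (auto simp: fps_X_power_mult_nth)
qed

section \<open>Reducing integer series modulo a prime\<close>

definition reduce_fps :: "int fps \<Rightarrow> 'a::comm_ring_1 fps" where
  "reduce_fps G = Abs_fps (\<lambda>n. of_int (fps_nth G n))"

lemma reduce_fps_nth [simp]: "fps_nth (reduce_fps G) n = of_int (fps_nth G n)"
  by (simp add: reduce_fps_def)

lemma reduce_fps_simps [simp]:
  "reduce_fps 1 = 1" "reduce_fps fps_X = fps_X"
  "reduce_fps (G + H) = reduce_fps G + reduce_fps H"
  "reduce_fps (G - H) = reduce_fps G - reduce_fps H"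
  "reduce_fps (G * H) = reduce_fps G * reduce_fps H"
  by (simp_all add: fps_eq_iff fps_mult_nth fps_X_def)

lemma reduce_fps_power [simp]: "reduce_fps (G ^ n) = reduce_fps G ^ n"
  by (induction n) simp_all

lemma reduce_fps_numeral [simp]: "reduce_fps (numeral k) = numeral k"
  by (simp add: fps_eq_iff fps_numeral_nth)

lemma hankel_det_reduce_fps:
  "hankel_det n (reduce_fps G) = of_int (hankel_det n G)"
proof -
  have "mat n n (\<lambda>(i, j). fps_nth (reduce_fps G) (i + j)) =
      map_mat (of_int :: int \<Rightarrow> 'a) (mat n n (\<lambda>(i, j). fps_nth G (i + j)))"
    by (rule eq_matI) auto
  then show ?thesis by (simp only: hankel_det_def of_int_hom.hom_det)
qed

section \<open>A Riccati equation over Boolean rings\<close>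

text \<open>
The rings used here satisfy \<open>a * a = a\<close>, as the field with two elements does. Besides characteristic
2, the identity is what makes the linear coefficient of a continued fraction step equal to its
square, on which the invariance of the Riccati equation depends.
\<close>

lemma boolean_ring_two_eq_0:
  assumes "\<And>a::'a::comm_ring_1. a * a = a"
  shows "(2::'a) = 0"
proof -
  have "(2::'a) + 2 = 2 * 2" by simp
  also have "\<dots> = 2" by (rule assms)
  finally show ?thesis by (simp only: add_cancel_left_right)
qed

text \<open>
Squaring is the substitution of \<open>X^2\<close>. Writing \<open>G = c + X B\<close> gives \<open>G^2 = c + X^2 B^2\<close>, so the
coefficients can be read off two at a time.
\<close>

lemma nth_square_boolean_ring:
  fixes G :: "'a::comm_ring_1 fps"
  assumes idem: "\<And>a::'a. a * a = a"
  shows "fps_nth (G ^ 2) (2 * n) = fps_nth G n" "fps_nth (G ^ 2) (2 * n + 1) = 0"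
proof -
  have two: "(2::'a fps) = 0"
    using boolean_ring_two_eq_0[OF idem] by (simp add: numeral_fps_const)
  have "fps_nth (G ^ 2) (2 * n) = fps_nth G n \<and> fps_nth (G ^ 2) (2 * n + 1) = 0"
  proof (induction n arbitrary: G)
    case 0
    have "fps_nth G 0 * fps_nth G 1 + fps_nth G 1 * fps_nth G 0 = 2 * (fps_nth G 0 * fps_nth G 1)"
      by (simp add: algebra_simps)
    then show ?case
      by (simp add: power2_eq_square idem fps_mult_nth boolean_ring_two_eq_0[OF idem])
  next
    case (Suc n)
    let ?B = "fps_shift 1 G" and ?c = "fps_const (fps_nth G 0)"
    have "G = ?c + fps_X * ?B"
      by (simp add: fps_eq_iff)
    then have "G ^ 2 = ?c ^ 2 + 2 * (?c * fps_X * ?B) + fps_X ^ 2 * ?B ^ 2"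
      by (metis (no_types, lifting) power2_sum power_mult_distrib mult.assoc add.assoc add.commute)
    then have "G ^ 2 = ?c + fps_X ^ 2 * ?B ^ 2"
      by (simp add: two power2_eq_square idem)
    then show ?case using Suc[of ?B]
      by (simp add: fps_X_power_mult_nth)
  qed
  then show "fps_nth (G ^ 2) (2 * n) = fps_nth G n" "fps_nth (G ^ 2) (2 * n + 1) = 0"
    by simp_all
qed

text \<open>
In characteristic 2 the left-hand side is the derivative of \<open>(X + X^2) G\<close>, so with \<open>y = X G\<close> this is
the Riccati equation \<open>((1 + X) y)' = 1 + y^2\<close>.
\<close>

definition riccati :: "'a::comm_ring_1 fps \<Rightarrow> bool" where
  "riccati G \<longleftrightarrow> G + (fps_X + fps_X ^ 2) * fps_deriv G = 1 + fps_X ^ 2 * G ^ 2"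

text \<open>
The odd coefficients of a derivative vanish, as they do for \<open>1 + X^2 G^2\<close>. The even coefficients
\<open>2 n + 2\<close> of the two sides are \<open>G (2 n + 1) + G (2 n + 2)\<close> and the coefficient \<open>2 n\<close> of \<open>G^2\<close>, which
is \<open>G n\<close>.
\<close>

lemma riccati_if_recurrence:
  fixes G :: "'a::comm_ring_1 fps"
  assumes idem: "\<And>a::'a. a * a = a"
    and G_0: "fps_nth G 0 = 1"
    and rec: "\<And>n. fps_nth G n = fps_nth G (2 * n + 1) + fps_nth G (2 * n + 2)"
  shows "riccati G"
  unfolding riccati_def
proof (rule fps_ext)
  fix n :: nat
  let ?L = "G + (fps_X + fps_X ^ 2) * fps_deriv G" and ?R = "1 + fps_X ^ 2 * G ^ 2"
  have two: "(2::'a) = 0" by (rule boolean_ring_two_eq_0[OF idem])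
  have even_0: "of_nat (2 * k) = (0::'a)" for k by (simp add: two)
  have L: "fps_nth ?L (Suc k) = of_nat (Suc (Suc k)) * fps_nth G (Suc k) + of_nat k * fps_nth G k" for k
    by (cases k) (simp_all add: distrib_right fps_X_power_mult_nth add.assoc)
  show "fps_nth ?L n = fps_nth ?R n"
  proof (cases n)
    case 0
    then show ?thesis by (simp add: G_0)
  next
    case (Suc k)
    show ?thesis
    proof (cases "even k")
      case True
      then obtain m where k: "k = 2 * m" by blast
      have "fps_nth ?L n = 0"
        unfolding Suc L k using even_0[of m] even_0[of "Suc m"] by simp
      moreover have "fps_nth ?R n = 0"
      proof (cases m)
        case 0
        then show ?thesis by (simp add: Suc k fps_X_power_mult_nth)
      next
        case (Suc l)
        then have "n - 2 = 2 * l + 1" using \<open>n = Suc k\<close> k by simp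
        then show ?thesis using nth_square_boolean_ring(2)[OF idem, of G l] \<open>n = Suc k\<close>
          by (simp add: fps_X_power_mult_nth)
      qed
      ultimately show ?thesis by simp
    next
      case False
      then obtain m where k: "k = 2 * m + 1" by (elim oddE)
      have "fps_nth ?L n = fps_nth G (2 * m + 2) + fps_nth G (2 * m + 1)"
        unfolding Suc L k using even_0[of m] even_0[of "Suc m"] by simp
      also have "\<dots> = fps_nth G m"
        by (simp add: rec[of m] add.commute)
      also have "\<dots> = fps_nth ?R n"
        using nth_square_boolean_ring(1)[OF idem, of G m] by (simp add: Suc k fps_X_power_mult_nth)
      finally show ?thesis .
    qed
  qed
qed

lemma fps_X_square_cancel:
  fixes G H :: "'a::comm_ring_1 fps"
  assumes "fps_X ^ 2 * G = fps_X ^ 2 * H"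
  shows "G = H"
proof (rule fps_ext)
  fix n
  from arg_cong[OF assms, of "\<lambda>f. fps_nth f (n + 2)"] show "fps_nth G n = fps_nth H n"
    by (simp add: fps_X_power_mult_nth)
qed

text \<open>
With \<open>q = 1 / G\<close> the equation becomes \<open>q + (X + X^2) q' = q^2 + X^2\<close>. Inserting
\<open>q = 1 + a X + X^2 K\<close>, everything that does not contain \<open>K\<close> cancels up to \<open>X^2\<close>, because
\<open>a^2 = a\<close>, and division by \<open>X^2\<close> leaves the original equation for \<open>K\<close>.
\<close>

lemma riccati_J_fraction:
  fixes G K :: "'a::comm_ring_1 fps"
  assumes idem: "\<And>a::'a. a * a = a"
    and G: "riccati G"
    and GK: "G * (1 + fps_const a * fps_X + fps_X ^ 2 * K) = 1"
  shows "riccati K"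
proof -
  define q where "q = 1 + fps_const a * fps_X + fps_X ^ 2 * K"
  have Gq: "G * q = 1" using GK by (simp add: q_def)
  have two: "(2::'a fps) = 0"
    using boolean_ring_two_eq_0[OF idem] by (simp add: numeral_fps_const)
  have neg: "- f = f" for f :: "'a fps"
    using two by (metis add.inverse_unique mult_2 mult_zero_left)
  define A :: "'a fps" where "A = fps_X + fps_X ^ 2"
  have dq: "fps_deriv q = fps_const a + fps_X ^ 2 * fps_deriv K"
    using two by (simp add: q_def fps_deriv_power)
  have "fps_deriv G * q + G * fps_deriv q = 0"
    using arg_cong[OF Gq, of fps_deriv] by (simp add: add.commute)
  moreover have "fps_deriv G * q ^ 2 =
      (fps_deriv G * q + G * fps_deriv q) * q - (G * q) * fps_deriv q"
    by (simp add: power2_eq_square algebra_simps)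
  ultimately have dG: "fps_deriv G * q ^ 2 = fps_deriv q"
    by (simp add: Gq neg)
  have "(G * q) * q + A * (fps_deriv G * q ^ 2) = (G + A * fps_deriv G) * q ^ 2"
    by (simp add: power2_eq_square algebra_simps)
  also have "\<dots> = (1 + fps_X ^ 2 * G ^ 2) * q ^ 2"
    using G by (simp add: riccati_def A_def)
  also have "\<dots> = q ^ 2 + fps_X ^ 2 * (G * q) ^ 2"
    by (simp add: power2_eq_square algebra_simps)
  finally have qq: "q + A * fps_deriv q = q ^ 2 + fps_X ^ 2"
    by (simp add: Gq dG)
  \<comment> \<open>The right-hand side records the relations by which the two expressions agree:
    the transformed equation, characteristic 2, and \<open>a * a = a\<close>.\<close>
  have "fps_X ^ 2 * (K + A * fps_deriv K) - fps_X ^ 2 * (1 + fps_X ^ 2 * K ^ 2) =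
      ((q + A * fps_deriv q) - (q ^ 2 + fps_X ^ 2))
      + 2 * (fps_X ^ 2 * K + fps_const a * fps_X ^ 3 * K)
      + (fps_const a * fps_const a - fps_const a) * fps_X ^ 2"
    unfolding dq unfolding q_def A_def
    by (simp add: power2_eq_square power3_eq_cube algebra_simps del: fps_const_mult)
  then have "fps_X ^ 2 * (K + A * fps_deriv K) = fps_X ^ 2 * (1 + fps_X ^ 2 * K ^ 2)"
    by (simp add: qq two idem)
  then have "fps_X ^ 2 * (K + (fps_X + fps_X ^ 2) * fps_deriv K) = fps_X ^ 2 * (1 + fps_X ^ 2 * K ^ 2)"
    unfolding A_def .
  then show ?thesis unfolding riccati_def by (rule fps_X_square_cancel)
qed

text \<open>
The equation at \<open>X = 0\<close> says that \<open>G\<close> has constant coefficient 1. Hence \<open>1 / G\<close> always has the form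
\<open>1 + a X + X^2 K\<close>, and each continued fraction step leads to a series of the same kind.
\<close>

theorem hankel_det_riccati:
  fixes G :: "'a::comm_ring_1 fps"
  assumes idem: "\<And>a::'a. a * a = a"
    and "riccati G"
  shows "hankel_det n G = 1"
  using assms(2)
proof (induction n arbitrary: G)
  case (Suc n)
  have G_0: "fps_nth G 0 = 1"
    using arg_cong[OF Suc.prems[unfolded riccati_def], of "\<lambda>f. fps_nth f 0"] by simp
  define q where "q = fps_right_inverse G 1"
  define K where "K = fps_shift 2 q"
  have Gq: "G * q = 1"
    unfolding q_def by (rule fps_right_inverse) (simp add: G_0)
  have "fps_nth q 0 = 1"
    using arg_cong[OF Gq, of "\<lambda>f. fps_nth f 0"] by (simp add: G_0)
  then have "q = 1 + fps_const (fps_nth q 1) * fps_X + fps_X ^ 2 * K"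
    using fps_eq_const_linear_shift[of q] by (simp add: K_def)
  with Gq have GK: "G * (1 + fps_const (fps_nth q 1) * fps_X + fps_X ^ 2 * K) = 1"
    by simp
  have "(- 1 :: 'a) = 1"
    using boolean_ring_two_eq_0[OF idem] by (metis add.inverse_inverse add_eq_0_iff one_add_one)
  then have "(- 1 :: 'a) ^ n = 1" by (metis power_one)
  moreover have "hankel_det (Suc n) G = (- 1) ^ n * hankel_det n K"
    by (rule hankel_det_Suc_J_fraction) (use GK in simp)
  ultimately show ?case
    using Suc.IH[OF riccati_J_fraction[OF idem Suc.prems GK]] by simp
qed simp

section \<open>The signs of the coefficients\<close>

lemma nat_cases_mod_3:
  obtains m where "n = 3 * m" | m where "n = 3 * m + 1" | m where "n = 3 * m + (2::nat)"
proof -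
  have "n = 3 * (n div 3) + n mod 3" by simp
  moreover have "n mod 3 = 0 \<or> n mod 3 = 1 \<or> n mod 3 = 2" by linarith
  ultimately show ?thesis using that by (metis add.right_neutral)
qed

text \<open>
The three terms of the factor \<open>1 - X - X^2\<close> act on disjoint residue classes of exponents modulo 3.
\<close>

lemma nth_compose_X_cubed:
  fixes G :: "'a::comm_ring_1 fps"
  defines "H \<equiv> (1 - fps_X - fps_X ^ 2) * (G oo fps_X ^ 3)"
  shows "fps_nth H (3 * m) = fps_nth G m"
    and "fps_nth H (3 * m + 1) = - fps_nth G m"
    and "fps_nth H (3 * m + 2) = - fps_nth G m"
proof -
  have eq: "H = (G oo fps_X ^ 3) - fps_X * (G oo fps_X ^ 3) - fps_X ^ 2 * (G oo fps_X ^ 3)"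
    by (simp add: H_def left_diff_distrib)
  have 1: "\<not> 3 dvd 3 * m - Suc 0" if "m > 0" using that by presburger
  have 2: "\<not> 3 dvd 3 * m - 2" if "m > 0" using that by presburger
  have 3: "\<not> 3 dvd Suc (3 * m)" "\<not> 3 dvd Suc (Suc (3 * m))" by presburger+
  show "fps_nth H (3 * m) = fps_nth G m"
    using 1 2 by (cases "m = 0") (auto simp: eq fps_X_power_mult_nth fps_nth_compose_X_power)
  show "fps_nth H (3 * m + 1) = - fps_nth G m"
    using 1 3 by (cases "m = 0") (auto simp: eq fps_X_power_mult_nth fps_nth_compose_X_power)
  show "fps_nth H (3 * m + 2) = - fps_nth G m"
    using 3 by (auto simp: eq fps_X_power_mult_nth fps_nth_compose_X_power)
qed

text \<open>
The substitution of \<open>X^3\<close> maps each factor of the product to the next one. The equation holds for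
partial products with one more factor on the left, and each coefficient of them stabilises.
\<close>

lemma F3_functional_equation: "F3 = (1 - fps_X - fps_X ^ 2) * (F3 oo fps_X ^ 3)"
proof -
  define f :: "nat \<Rightarrow> int fps" where "f = (\<lambda>k. 1 - fps_X ^ (3 ^ k) - fps_X ^ (2 * 3 ^ k))"
  define P where "P n = (\<Prod>k<n. f k)" for n
  have "P \<longlonglongrightarrow> F3"
    using has_prod_imp_tendsto'[OF F3_has_prod] unfolding P_def f_def .
  then have lim: "eventually (\<lambda>n. fps_nth (P n) j = fps_nth F3 j) sequentially" for j
    by (simp add: tendsto_fps_iff)
  have lim_Suc: "eventually (\<lambda>n. fps_nth (P (Suc n)) j = fps_nth F3 j) sequentially" for j
    using lim[of j] by (rule eventually_sequentially_Suc[THEN iffD2])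
  have f_Suc: "f (Suc k) = f k oo fps_X ^ 3" for k
    by (simp add: f_def fps_compose_sub_distrib fps_compose_power[symmetric] power_mult[symmetric] mult_ac)
  have P_Suc: "P (Suc n) = (1 - fps_X - fps_X ^ 2) * (P n oo fps_X ^ 3)" for n
  proof -
    have "P (Suc n) = f 0 * (\<Prod>k<n. f (Suc k))"
      unfolding P_def by (rule prod.lessThan_Suc_shift)
    then show ?thesis
      by (simp add: f_Suc P_def fps_compose_prod_distrib) (simp add: f_def)
  qed
  have div_3: "(3 * m + 1) div 3 = m" "(3 * m + 2) div 3 = m" "(3 * m) div 3 = m" for m :: nat
    by simp_all
  show ?thesis
  proof (rule fps_ext)
    fix j
    have "\<exists>n. fps_nth (P (Suc n)) j = fps_nth F3 j \<and> fps_nth (P n) (j div 3) = fps_nth F3 (j div 3)"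
      using eventually_happens[OF eventually_conj[OF lim_Suc lim]] by simp
    then obtain n where "fps_nth (P (Suc n)) j = fps_nth F3 j"
      "fps_nth (P n) (j div 3) = fps_nth F3 (j div 3)" by blast
    then show "fps_nth F3 j = fps_nth ((1 - fps_X - fps_X ^ 2) * (F3 oo fps_X ^ 3)) j"
      unfolding P_Suc
      by (cases j rule: nat_cases_mod_3)
        (simp_all only: nth_compose_X_cubed div_3)
  qed
qed

lemma F3_nth:
  "fps_nth F3 (3 * m) = fps_nth F3 m"
  "fps_nth F3 (3 * m + 1) = - fps_nth F3 m"
  "fps_nth F3 (3 * m + 2) = - fps_nth F3 m"
  using nth_compose_X_cubed[of F3 m] F3_functional_equation by simp_all


lemma F3_nth_0: "fps_nth F3 0 = 1"
proof -
  have P_0: "(\<Prod>k<n. 1 - fps_X ^ 3 ^ k - fps_X ^ (2 * 3 ^ k) :: int fps) $ 0 = 1" for n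
    by (induction n) simp_all
  have "\<exists>n. (\<Prod>k<n. 1 - fps_X ^ 3 ^ k - fps_X ^ (2 * 3 ^ k) :: int fps) $ 0 = F3 $ 0"
    using has_prod_imp_tendsto'[OF F3_has_prod]
    by (auto simp: tendsto_fps_iff intro!: eventually_happens'[of sequentially])
  then show ?thesis by (auto simp: P_0)
qed

text \<open>
This is the parity of the number of nonzero ternary digits of \<open>n\<close>, since each such digit
contributes a sign to the coefficient of \<open>X ^ n\<close> in \<open>F3\<close>. An integer value, not a Boolean one, lets
it serve as the coefficient sequence of an integer series.
\<close>

definition digit_parity :: "nat \<Rightarrow> int" where
  "digit_parity n = (1 - fps_nth F3 n) div 2"

lemma F3_nth_cases: "fps_nth F3 n = 1 \<or> fps_nth F3 n = - 1"
proof (induction n rule: less_induct)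
  case (less n)
  show ?case
  proof (cases n rule: nat_cases_mod_3)
    case (1 m)
    then show ?thesis using less[of m] F3_nth_0 by (cases "m = 0") (auto simp: F3_nth)
  next
    case (2 m)
    then show ?thesis using less[of m] F3_nth(2)[of m] by auto
  next
    case (3 m)
    then show ?thesis using less[of m] F3_nth(3)[of m] by auto
  qed
qed

text \<open>
If \<open>m\<close> is not 2 modulo 3, then \<open>m\<close> and \<open>m + 1\<close> differ only in the last digit, as do \<open>2 m + 1\<close> and
\<open>2 m + 2\<close>, and exactly one of the two pairs has a change from 0 to a nonzero digit. For \<open>m = 3 k + 2\<close>
a carry occurs in both pairs and reduces the claim to \<open>k\<close>.
\<close>

lemma F3_nth_mult_Suc:
  "fps_nth F3 m * fps_nth F3 (m + 1) = - (fps_nth F3 (2 * m + 1) * fps_nth F3 (2 * m + 2))"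
proof (induction m rule: less_induct)
  case (less m)
  have sq: "fps_nth F3 k * fps_nth F3 k = 1" for k
    using F3_nth_cases[of k] by auto
  show ?case
  proof (cases m rule: nat_cases_mod_3)
    case (1 k)
    have eqs: "2 * m + 1 = 3 * (2 * k) + 1" "2 * m + 2 = 3 * (2 * k) + 2" using 1 by simp_all
    show ?thesis unfolding eqs unfolding 1 F3_nth by (simp add: sq)
  next
    case (2 k)
    have eqs: "m + 1 = 3 * k + 2" "2 * m + 1 = 3 * (2 * k + 1)" "2 * m + 2 = 3 * (2 * k + 1) + 1"
      using 2 by simp_all
    show ?thesis unfolding eqs unfolding 2 F3_nth by (simp add: sq)
  next
    case (3 k)
    have eqs: "m + 1 = 3 * (k + 1)" "2 * m + 1 = 3 * (2 * k + 1) + 2" "2 * m + 2 = 3 * (2 * k + 2)"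
      using 3 by simp_all
    show ?thesis unfolding eqs unfolding 3 F3_nth using less[of k] 3 by simp
  qed
qed

lemma F3_nth_eq_digit_parity: "fps_nth F3 n = 1 - 2 * digit_parity n"
  using F3_nth_cases[of n] by (auto simp: digit_parity_def)

lemma digit_parity_doubling:
  "odd (digit_parity m + digit_parity (m + 1) + digit_parity (2 * m + 1) + digit_parity (2 * m + 2))"
proof -
  define a b c d where "a = digit_parity m" "b = digit_parity (m + 1)"
    "c = digit_parity (2 * m + 1)" "d = digit_parity (2 * m + 2)"
  have "(1 - 2 * a) * (1 - 2 * b) = - ((1 - 2 * c) * (1 - 2 * d))"
    using F3_nth_mult_Suc[of m] unfolding F3_nth_eq_digit_parity a_b_c_d_def .
  then have "a + b + c + d = 2 * (a * b + c * d) + 1"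
    by (simp add: algebra_simps)
  then show ?thesis unfolding a_b_c_d_def by presburger
qed

section \<open>Splitting off the powers of two\<close>

text \<open>
Let \<open>D\<close> be the generating series of the digit parities, so that \<open>(1 - X) F3 = 1 - 2 (1 - X) D\<close>.
For \<open>q = 1 / F3\<close> this gives \<open>q = 1 - X + 2 s\<close> with \<open>s = (1 - X) D q\<close>, and \<open>s = X + X^2 K\<close> because
the first two digit parities are 0 and 1. Replacing \<open>q\<close> by \<open>1 - X\<close> in \<open>s\<close> shows that \<open>s\<close> is
\<open>(1 + X^2) D\<close> modulo 2, which contains the coefficients of \<open>K\<close>.
\<close>

lemma F3_J_fraction:
  obtains K :: "int fps" where
    "F3 * (1 + fps_X + 2 * fps_X ^ 2 * K) = 1"
    "\<And>m. even (fps_nth K m - (digit_parity m + digit_parity (m + 2)))"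
proof -
  define D where "D = Abs_fps digit_parity"
  define q where "q = fps_right_inverse F3 1"
  define s where "s = (1 - fps_X) * (D * q)"
  define K where "K = fps_shift 2 s"
  have D: "digit_parity 0 = 0" "digit_parity (Suc 0) = 1"
    using F3_nth(2)[of 0] by (simp_all add: digit_parity_def F3_nth_0)
  have Fq: "F3 * q = 1"
    unfolding q_def by (rule fps_right_inverse) (simp add: F3_nth_0)
  have q_0: "fps_nth q 0 = 1"
    using arg_cong[OF Fq, of "\<lambda>f. fps_nth f 0"] by (simp add: F3_nth_0)
  have "(1 - fps_X) * F3 = 1 - 2 * (1 - fps_X) * D"
  proof (rule fps_ext)
    fix n show "fps_nth ((1 - fps_X) * F3) n = fps_nth (1 - 2 * (1 - fps_X) * D) n"
      by (cases n) (simp_all add: left_diff_distrib mult.assoc F3_nth_eq_digit_parity D_def D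
        numeral_fps_const algebra_simps)
  qed
  then have "(1 - fps_X) * (F3 * q) = q - 2 * s"
    by (simp only: s_def mult.assoc[symmetric]) (simp add: algebra_simps)
  then have q: "q = 1 - fps_X + 2 * s"
    by (simp add: Fq algebra_simps)
  have "fps_nth s 0 = 0" "fps_nth s 1 = 1"
    by (simp_all add: s_def left_diff_distrib fps_mult_nth D_def D q_0)
  then have s: "s = fps_X + fps_X ^ 2 * K"
    using fps_eq_const_linear_shift[of s] by (simp add: K_def)
  have Fk: "F3 * (1 + fps_X + 2 * fps_X ^ 2 * K) = 1"
    using Fq unfolding q s by (simp add: algebra_simps)
  define V where "V = (1 - fps_X) * (D * s) - fps_X * D"
  have "s = (1 - fps_X) * (D * (1 - fps_X + 2 * s))"
    by (subst q[symmetric]) (rule s_def)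
  also have "\<dots> = D + fps_X ^ 2 * D + fps_const 2 * V"
    by (simp add: V_def power2_eq_square algebra_simps flip: numeral_fps_const)
  finally have "fps_nth s (m + 2) = digit_parity (m + 2) + digit_parity m + 2 * fps_nth V (m + 2)" for m
    by (simp add: D_def fps_X_power_mult_nth)
  then have "fps_nth K m = digit_parity (m + 2) + digit_parity m + 2 * fps_nth V (m + 2)" for m
    by (simp add: K_def)
  then have "even (fps_nth K m - (digit_parity m + digit_parity (m + 2)))" for m
    by simp
  with Fk show ?thesis by (rule that)
qed

section \<open>The quotient modulo 2\<close>

text \<open>
By \<open>digit_parity_doubling\<close> for \<open>n\<close> and for \<open>n + 1\<close>, the coefficients of \<open>K\<close> satisfy the recurrence
behind the Riccati equation.
\<close>

lemma odd_hankel_det_quotient: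
  assumes K: "\<And>m. even (fps_nth K m - (digit_parity m + digit_parity (m + 2)))"
  shows "odd (hankel_det n K)"
proof -
  have dvd: "of_int x = (0::2) \<longleftrightarrow> even x" for x :: int
    by (simp add: of_int_eq_0_iff_char_dvd)
  have idem: "a * a = a" for a :: 2
  proof (cases a)
    case (of_int z)
    have "even (z * z - z)" by simp
    then have "of_int (z * z - z) = (0::2)" by (simp only: dvd)
    then show ?thesis by (simp add: of_int)
  qed
  let ?G = "reduce_fps K :: 2 fps"
  have "riccati ?G"
  proof (rule riccati_if_recurrence[OF idem])
    have "odd (fps_nth K 0)"
      using K[of 0] F3_nth(2)[of 0] F3_nth(3)[of 0]
      by (simp add: digit_parity_def F3_nth_0 numeral_2_eq_2)
    then have "of_int (fps_nth K 0 - 1) = (0::2)"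
      unfolding dvd by simp
    then show "fps_nth ?G 0 = 1" by simp
  next
    fix n
    have "even (fps_nth K n - (fps_nth K (2 * n + 1) + fps_nth K (2 * n + 2)))"
      using digit_parity_doubling[of n] digit_parity_doubling[of "n + 1"]
        K[of n] K[of "2 * n + 1"] K[of "2 * n + 2"]
      by (simp add: numeral_eq_Suc) presburger
    then have "of_int (fps_nth K n - (fps_nth K (2 * n + 1) + fps_nth K (2 * n + 2))) = (0::2)"
      by (simp only: dvd)
    then show "fps_nth ?G n = fps_nth ?G (2 * n + 1) + fps_nth ?G (2 * n + 2)"
      by simp
  qed
  then have "of_int (hankel_det n K) = (1::2)"
    using hankel_det_riccati[OF idem] by (simp add: hankel_det_reduce_fps[symmetric])
  then have "of_int (hankel_det n K - 1) = (0::2)" by simp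
  then show ?thesis unfolding dvd by simp
qed

section \<open>The quotient modulo 3\<close>

text \<open>
Let \<open>f = 1 - X - X^2\<close>, and let \<open>C\<close> be \<open>F3\<close> evaluated at \<open>X^3\<close>, so that \<open>F3 = f C\<close>. Then
\<open>E = F3^2 f = f^3 C^2\<close>, and modulo 3 this is \<open>E\<close> evaluated at \<open>X^3\<close>, because \<open>f^3\<close> is \<open>f\<close> evaluated
at \<open>X^3\<close>. A series that is invariant under this substitution is constant. The comparison takes
place over the integers, with an explicit multiple of 3.
\<close>

lemma F3_square_mod_3:
  assumes three: "(3::'a::comm_ring_1) = 0"
  shows "reduce_fps F3 ^ 2 * (1 - fps_X - fps_X ^ 2) = (1 :: 'a fps)"
proof -
  define f :: "int fps" where "f = 1 - fps_X - fps_X ^ 2"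
  \<comment> \<open>From \<open>(a + b + c)^3 = a^3 + b^3 + c^3 + 3 (a + b) (b + c) (c + a)\<close> for the terms of \<open>f\<close>.\<close>
  define w :: "int fps" where "w = - ((1 - fps_X) * (fps_X + fps_X ^ 2) * (1 - fps_X ^ 2))"
  define C where "C = F3 oo fps_X ^ 3"
  define E where "E = F3 ^ 2 * f"
  have F3_eq: "F3 = f * C"
    using F3_functional_equation by (simp add: f_def C_def)
  have f_compose: "f oo fps_X ^ 3 = 1 - fps_X ^ 3 - fps_X ^ 6"
    by (simp add: f_def fps_compose_sub_distrib fps_compose_power[symmetric] power_mult[symmetric])
  have E_compose: "E oo fps_X ^ 3 = C ^ 2 * (f oo fps_X ^ 3)"
    by (simp add: E_def C_def fps_compose_mult_distrib fps_compose_power)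
  have f_cube: "f ^ 3 = (f oo fps_X ^ 3) + 3 * w"
    unfolding f_compose unfolding f_def w_def
    by (simp add: power_numeral_reduce algebra_simps)
  have "E = f ^ 3 * C ^ 2"
    unfolding E_def F3_eq by (simp add: power2_eq_square power3_eq_cube mult_ac)
  then have "E = (E oo fps_X ^ 3) + fps_const 3 * (w * C ^ 2)"
    unfolding E_compose f_cube by (simp add: algebra_simps numeral_fps_const)
  then have E_nth: "fps_nth E n =
      (if 3 dvd n then fps_nth E (n div 3) else 0) + 3 * fps_nth (w * C ^ 2) n" for n
    by (rule trans[OF arg_cong[of _ _ "\<lambda>g. fps_nth g n"]])
      (simp add: fps_nth_compose_X_power del: fps_const_mult)
  have E_dvd: "3 dvd fps_nth E n" if "n > 0" for n
    using that
  proof (induction n rule: less_induct)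
    case (less n)
    show ?case
    proof (cases "3 dvd n")
      case True
      then have "n div 3 > 0" "n div 3 < n" using less.prems by auto
      then show ?thesis using less.IH[of "n div 3"] by (subst E_nth) simp
    next
      case False
      then show ?thesis by (subst E_nth) simp
    qed
  qed
  have E_0: "fps_nth E 0 = 1"
    by (simp add: E_def f_def F3_nth_0 power2_eq_square)
  have "reduce_fps F3 ^ 2 * (1 - fps_X - fps_X ^ 2) = (reduce_fps E :: 'a fps)"
    by (simp add: E_def f_def)
  also have "\<dots> = 1"
  proof (rule fps_ext)
    fix n show "fps_nth (reduce_fps E) n = fps_nth (1 :: 'a fps) n"
      using E_dvd[of n] E_0 three by (cases "n = 0") (auto elim!: dvdE)
  qed
  finally show ?thesis .
qed

text \<open>
The reciprocal \<open>q = 1 + X + 2 X^2 K\<close> of \<open>F\<close> has the square \<open>1 - X - X^2\<close>. Modulo 3 this quadratic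
equation for \<open>q\<close> becomes one for \<open>K\<close>, multiplied by \<open>X^2\<close>.
\<close>

lemma quotient_equation_mod_3:
  fixes F K :: "'a::comm_ring_1 fps"
  assumes three: "(3::'a) = 0"
    and F: "F ^ 2 * (1 - fps_X - fps_X ^ 2) = 1"
    and FK: "F * (1 + fps_X + 2 * fps_X ^ 2 * K) = 1"
  shows "K * (1 + fps_X + fps_X ^ 2 * K) = 1"
proof -
  have three': "(3::'a fps) = 0"
    using three by (simp add: numeral_fps_const)
  define q where "q = 1 + fps_X + 2 * fps_X ^ 2 * K"
  have "q ^ 2 = q ^ 2 * (F ^ 2 * (1 - fps_X - fps_X ^ 2))"
    by (simp add: F)
  also have "\<dots> = (F * q) ^ 2 * (1 - fps_X - fps_X ^ 2)"
    by (simp only: power_mult_distrib mult_ac)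
  finally have q2: "q ^ 2 = 1 - fps_X - fps_X ^ 2"
    using FK by (simp add: q_def)
  have "fps_X ^ 2 * (K * (1 + fps_X + fps_X ^ 2 * K)) - fps_X ^ 2 * 1 =
      (q ^ 2 - (1 - fps_X - fps_X ^ 2))
      - 3 * (fps_X + fps_X ^ 2 + fps_X ^ 2 * (K * (1 + fps_X + fps_X ^ 2 * K)))"
    unfolding q_def by (simp add: power2_eq_square algebra_simps)
  then have "fps_X ^ 2 * (K * (1 + fps_X + fps_X ^ 2 * K)) = fps_X ^ 2 * 1"
    by (simp add: q2 three')
  then show ?thesis by (rule fps_X_square_cancel)
qed

lemma hankel_det_periodic_J_fraction:
  fixes K :: "'a::comm_ring_1 fps"
  assumes "K * (1 + fps_X + fps_X ^ 2 * K) = 1"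
  shows "hankel_det n K = (- 1) ^ (n choose 2)"
proof (induction n)
  case (Suc n)
  have "hankel_det (Suc n) K = (- 1) ^ n * hankel_det n K"
    by (rule hankel_det_Suc_J_fraction[where a = 1]) (use assms in simp)
  then show ?case
    by (simp add: Suc numeral_2_eq_2 power_add)
qed (simp add: numeral_2_eq_2)

lemma hankel_det_quotient_mod_3:
  assumes "F3 * (1 + fps_X + 2 * fps_X ^ 2 * K) = 1"
  shows "3 dvd hankel_det n K - (- 1) ^ (n choose 2)"
proof -
  have three: "(3::3) = 0" by simp
  have "reduce_fps F3 * (1 + fps_X + 2 * fps_X ^ 2 * reduce_fps K) = (1 :: 3 fps)"
    using arg_cong[OF assms, of "reduce_fps :: int fps \<Rightarrow> 3 fps"] by simp
  note quotient_equation_mod_3[OF three F3_square_mod_3[OF three] this]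
  then have "of_int (hankel_det n K) = (- 1 :: 3) ^ (n choose 2)"
    using hankel_det_periodic_J_fraction by (simp add: hankel_det_reduce_fps[symmetric])
  then have "of_int (hankel_det n K - (- 1) ^ (n choose 2)) = (0 :: 3)"
    by simp
  then show ?thesis
    by (simp add: of_int_eq_0_iff_char_dvd del: of_int_diff)
qed

section \<open>Combining the two moduli\<close>

lemma even_choose_two_iff: "even (n choose 2) \<longleftrightarrow> n mod 4 = 0 \<or> n mod 4 = 1"
proof (induction n)
  case (Suc n)
  have "Suc n choose 2 = n + (n choose 2)" by (simp add: numeral_2_eq_2)
  then show ?case using Suc by simp presburger
qed (simp add: numeral_2_eq_2)

theorem corollary1p4:
  fixes n :: nat
  assumes "n \<ge> 1"
  shows "2 ^ (n - 1) dvd hankel_det n F3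
    \<and> (n mod 4 = 0 \<or> n mod 4 = 1 \<longrightarrow> [hankel_det n F3 div 2 ^ (n - 1) = 1] (mod 6))
    \<and> (n mod 4 = 2 \<or> n mod 4 = 3 \<longrightarrow> [hankel_det n F3 div 2 ^ (n - 1) = 5] (mod 6))"
proof -
  obtain m where n: "n = Suc m"
    using assms by (cases n) auto
  obtain K where FK: "F3 * (1 + fps_X + 2 * fps_X ^ 2 * K) = 1"
    and K: "\<And>m. even (fps_nth K m - (digit_parity m + digit_parity (m + 2)))"
    using F3_J_fraction by blast
  define v where "v = (- 1) ^ m * hankel_det m K"
  have "hankel_det n F3 = (- 2) ^ m * hankel_det m K"
    unfolding n
    by (rule hankel_det_Suc_J_fraction[where a = 1]) (use FK in \<open>simp add: numeral_fps_const\<close>)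
  then have H: "hankel_det n F3 = 2 ^ m * v"
    by (simp add: v_def power_minus[of 2])
  have v_odd: "odd v"
    using odd_hankel_det_quotient[OF K] by (simp add: v_def)
  have "n choose 2 = m + (m choose 2)"
    by (simp add: n numeral_2_eq_2)
  then have "v - (- 1) ^ (n choose 2) = (- 1) ^ m * (hankel_det m K - (- 1) ^ (m choose 2))"
    by (simp add: v_def power_add right_diff_distrib)
  then have v_3: "3 dvd v - (- 1) ^ (n choose 2)"
    using hankel_det_quotient_mod_3[OF FK] by simp
  have "[v = 1] (mod 6)" if "n mod 4 = 0 \<or> n mod 4 = 1"
  proof -
    have "3 dvd v - 1" using v_3 that even_choose_two_iff[of n] by simp
    with v_odd show ?thesis unfolding cong_iff_dvd_diff by presburger
  qed
  moreover have "[v = 5] (mod 6)" if "n mod 4 = 2 \<or> n mod 4 = 3"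
  proof -
    have "odd (n choose 2)" using that even_choose_two_iff[of n] by auto
    then have "3 dvd v + 1" using v_3 by simp
    with v_odd show ?thesis unfolding cong_iff_dvd_diff by presburger
  qed
  ultimately show ?thesis
    by (simp add: H) (simp add: n)
qed

end
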